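(* Consider the surface defined over $\mathbb{Q}$ by $$4x^2 + (y^2 + 1 - z^2)^2 = 8y^2.$$ Every rational point $(x,y,z)$ on this surface either lies on one of the 8 lines $x = \varepsilon_1 y = \varepsilon_2 z + \varepsilon_3$ with $\varepsilon_1, \varepsilon_2, \varepsilon_3 \in \{+1,-1\}$ chosen independently, or else there exists a pair of rational numbers $b, c$ such that, writing $$D = b^2c^2 + 2b^2 - 3b^2c + c - bc^2 + 2b,$$ we have $$x = -\frac{b(c^2 + 2 - 4c)}{D}, \qquad y = -\frac{b(c^2 + 2 - 2c)}{D}, \qquad z = -\frac{b^2c^2 + 2b^2 - 3b^2c - c}{D}.$$ Conversely, these expressions satisfy the equation $4x^2 + (y^2 + 1 - z^2)^2 = 8y^2$ identically (as rational functions of $b, c$), and for such a point the parameters are recovered by $$b = \frac{y - x}{u - z - 1}, \qquad c = \frac{4x(y - x)}{(x - u)(y + x) + (u + 3x)(y - x)},$$ where $u$ is defined by $y^2 + 1 - z^2 = 2u$. *)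

theory Defs
  imports "HOL-Computational_Algebra.Polynomial_Factorial"
begin

text \<open>The definitions are generic in the field because they are used both for numbers and for
  rational functions in the parameters. Only fields of characteristic zero are intended.\<close>

definition on_surface :: "'a::field \<Rightarrow> 'a \<Rightarrow> 'a \<Rightarrow> bool" where
  "on_surface x y z \<longleftrightarrow> 4 * x^2 + (y^2 + 1 - z^2)^2 = 8 * y^2"

definition on_lines :: "'a::field \<Rightarrow> 'a \<Rightarrow> 'a \<Rightarrow> bool" where
  "on_lines x y z \<longleftrightarrow>
     (\<exists>e1\<in>{1, -1}. \<exists>e2\<in>{1, -1}. \<exists>e3\<in>{1, -1}. x = e1 * y \<and> e1 * y = e2 * z + e3)"

definition param_D :: "'a::field \<Rightarrow> 'a \<Rightarrow> 'a" where
  "param_D b c = b^2 * c^2 + 2 * b^2 - 3 * b^2 * c + c - b * c^2 + 2 * b"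

definition param_x :: "'a::field \<Rightarrow> 'a \<Rightarrow> 'a" where
  "param_x b c = - (b * (c^2 + 2 - 4 * c) / param_D b c)"

definition param_y :: "'a::field \<Rightarrow> 'a \<Rightarrow> 'a" where
  "param_y b c = - (b * (c^2 + 2 - 2 * c) / param_D b c)"

definition param_z :: "'a::field \<Rightarrow> 'a \<Rightarrow> 'a" where
  "param_z b c = - ((b^2 * c^2 + 2 * b^2 - 3 * b^2 * c - c) / param_D b c)"

definition is_param :: "'a::field \<Rightarrow> 'a \<Rightarrow> 'a \<Rightarrow> 'a \<Rightarrow> 'a \<Rightarrow> bool" where
  "is_param b c x y z \<longleftrightarrow>
     param_D b c \<noteq> 0 \<and> x = param_x b c \<and> y = param_y b c \<and> z = param_z b c"

definition u_of :: "'a::field \<Rightarrow> 'a \<Rightarrow> 'a" where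
  "u_of y z = (y^2 + 1 - z^2) / 2"

definition b_den :: "'a::field \<Rightarrow> 'a \<Rightarrow> 'a" where
  "b_den y z = u_of y z - z - 1"

definition c_den :: "'a::field \<Rightarrow> 'a \<Rightarrow> 'a \<Rightarrow> 'a" where
  "c_den x y z = (x - u_of y z) * (y + x) + (u_of y z + 3 * x) * (y - x)"

definition b_of :: "'a::field \<Rightarrow> 'a \<Rightarrow> 'a \<Rightarrow> 'a" where
  "b_of x y z = (y - x) / b_den y z"

definition c_of :: "'a::field \<Rightarrow> 'a \<Rightarrow> 'a \<Rightarrow> 'a" where
  "c_of x y z = 4 * x * (y - x) / c_den x y z"

text \<open>The rational function field \<open>\<rat>(b, c)\<close>, as the fraction field of \<open>\<rat>[b][c]\<close>, with its
  indeterminates \<open>b\<close> (the inner variable) and \<open>c\<close> (the outer variable).\<close>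

type_synonym ratfun = "rat poly poly fract"

definition bvar :: ratfun where
  "bvar = to_fract [:[:0, 1:]:]"

definition cvar :: ratfun where
  "cvar = to_fract [:0, 1:]"

end

(* With y^2 + 1 - z^2 = 2u the surface is the intersection of the cone x^2 + u^2 = 2y^2 with
   the quadric z^2 = y^2 + 1 - 2u. The parameter c is the chord parameter of the conic
   x^2 + u^2 = 2y^2 based at (x : u : y) = (1 : 1 : 1), namely c = 2(y - x) / (2y - x - u), and
   for fixed c the remaining conic is parametrized by b = (y - x) / (u - z - 1). All denominators
   vanish only where x = y or x = -y, which on the surface is the union of the eight lines;
   clearing the extra factor x in the stated formula for c uses that 2 is not a rational square. *)

theory Submission
  imports Defs
begin

text \<open>With x^2 = y^2 the surface equation becomes an equality of squares, so y^2 + 1 - z^2 =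
  2sy for a sign s. This is (y - s)^2 = z^2, which splits into two lines for each s.\<close>

lemma on_linesI:
  fixes x y z :: "'a::field"
  assumes "(2::'a) \<noteq> 0" and "on_surface x y z" and "x = y \<or> x = - y"
  shows "on_lines x y z"
proof -
  have "x^2 = y^2" using assms(3) by auto
  then have "(y^2 + 1 - z^2)^2 = (2 * y)^2"
    using assms(2) unfolding on_surface_def by algebra
  then obtain s :: 'a where s: "s = 1 \<or> s = -1" and w: "y^2 + 1 - z^2 = 2 * s * y"
    unfolding power2_eq_iff by force
  have "(y - s)^2 = z^2" using s w by algebra
  then obtain t :: 'a where t: "t = 1 \<or> t = -1" and ys: "y = t * z + s"
    unfolding power2_eq_iff by (metis diff_eq_eq mult_1 mult_minus1)
  obtain e :: 'a where e: "e = 1 \<or> e = -1" and xe: "x = e * y"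
    using assms(3) by (metis mult_1 mult_minus1)
  have "e * y = (e * t) * z + e * s" using ys by algebra
  moreover have "e * t \<in> {1, -1}" "e * s \<in> {1, -1}" using e s t by auto
  ultimately show ?thesis unfolding on_lines_def using e xe by blast
qed

lemma conic_of_surface:
  fixes x y z :: "'a::field"
  assumes "(2::'a) \<noteq> 0" and "on_surface x y z"
  shows "x^2 + (u_of y z)^2 = 2 * y^2"
proof -
  have "2 * u_of y z = y^2 + 1 - z^2" using assms(1) by (simp add: u_of_def)
  then have "2 * 2 * (x^2 + (u_of y z)^2 - 2 * y^2) = 0"
    using assms(2) unfolding on_surface_def by algebra
  then have "x^2 + (u_of y z)^2 - 2 * y^2 = 0" using assms(1) by (metis mult_eq_0_iff)
  then show ?thesis by simp
qed

text \<open>If u = z + 1, the quadric 2u = y^2 + 1 - z^2 gives y^2 = (z + 1)^2 = u^2, and the cone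
  then forces x^2 = y^2.\<close>

lemma b_den_nonzero:
  fixes x y z :: "'a::field"
  assumes "(2::'a) \<noteq> 0" and "on_surface x y z" and "\<not> on_lines x y z"
  shows "b_den y z \<noteq> 0"
proof
  assume "b_den y z = 0"
  then have u: "u_of y z = z + 1" by (simp add: b_den_def algebra_simps)
  moreover have "2 * u_of y z = y^2 + 1 - z^2" using assms(1) by (simp add: u_of_def)
  ultimately have "y^2 = (z + 1)^2" by algebra
  then have "x^2 = y^2" using conic_of_surface[OF assms(1,2)] u by algebra
  then show False using on_linesI[OF assms(1,2)] assms(3) by (simp add: power2_eq_iff)
qed

text \<open>The equation 2y = x + u is the tangent to the conic at (1 : 1 : 1). It meets the conic
  only there, since (x - u)^2 = 2(x^2 + u^2) - (x + u)^2 vanishes on it.\<close>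

lemma conic_chord_nonzero:
  fixes x y z :: "'a::field"
  assumes "(2::'a) \<noteq> 0" and "on_surface x y z" and "\<not> on_lines x y z"
  shows "2 * y - x - u_of y z \<noteq> 0"
proof
  assume q: "2 * y - x - u_of y z = 0"
  then have "(x - u_of y z)^2 = 0"
    using conic_of_surface[OF assms(1,2)] by algebra
  then have "2 * (y - x) = 0" using q by (simp add: algebra_simps)
  then have "x = y" using assms(1) by simp
  then show False using on_linesI[OF assms(1,2)] assms(3) by blast
qed

text \<open>Thus the stated formula for c is the chord parameter 2(y - x) / (2y - x - u), expanded
  by 2x.\<close>

lemma c_den_eq:
  "c_den x y z = 2 * x * (2 * y - x - u_of y z)"
  unfolding c_den_def by algebra

text \<open>Using the chord parameter without the extra factor x keeps the argument valid over every
  field with 2 nonzero. The key relation is D = -4p/(qr), from which the three coordinates follow by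
  clearing denominators.\<close>

lemma is_param_of_surface:
  fixes x y z :: "'a::field"
  assumes two: "(2::'a) \<noteq> 0" and surf: "on_surface x y z" and lines: "\<not> on_lines x y z"
  shows "is_param ((y - x) / b_den y z) (2 * (y - x) / (2 * y - x - u_of y z)) x y z"
proof -
  define p q r u where "p = y - x" and "q = 2 * y - x - u_of y z" and "r = b_den y z"
    and "u = u_of y z"
  define b c where "b = p / r" and "c = 2 * p / q"
  have p: "p \<noteq> 0" using on_linesI[OF two surf] lines by (auto simp: p_def)
  have q: "q \<noteq> 0" unfolding q_def by (rule conic_chord_nonzero[OF assms])
  have r: "r \<noteq> 0" unfolding r_def by (rule b_den_nonzero[OF assms])
  have br: "b * r = p" and cq: "c * q = 2 * p" using q r by (simp_all add: b_def c_def)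
  have conic: "x^2 + u^2 = 2 * y^2" unfolding u_def by (rule conic_of_surface[OF two surf])
  have u2: "2 * u = y^2 + 1 - z^2" using two by (simp add: u_def u_of_def)
  have defs: "p = y - x" "q = 2 * y - x - u" "r = u - z - 1"
    by (simp_all add: p_def q_def r_def u_def b_den_def)
  \<comment> \<open>\<open>X\<close>, \<open>Y\<close>, \<open>U\<close> express the chord
    parametrization x : y : u = c^2 + 2 - 4c : c^2 + 2 - 2c : c^2 - 2 with c = 2p/q.\<close>
  have Y: "2 * p^2 + q^2 - 2 * p * q = 2 * y * q" using defs conic by algebra
  have X: "2 * p^2 + q^2 - 4 * p * q = 2 * x * q" using defs conic by algebra
  have U: "2 * p^2 - q^2 = 2 * u * q" using defs conic by algebra
  \<comment> \<open>The quadric 2u = y^2 + 1 - z^2 after putting z = u - r - 1 and using u^2 - y^2 =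
    y^2 - x^2 = p(2y - p).\<close>
  have R: "2 * p * y - p^2 + r^2 - 2 * u * r + 2 * r = 0" using defs conic u2 by algebra
  \<comment> \<open>Multiplied by q^2 r^2, D is a polynomial in br, cq, q and r, so b and c can be
    eliminated by \<open>br\<close> and \<open>cq\<close>.\<close>
  have "q * (q * r * (param_D b c * (q * r) + 4 * p)) = 0"
  proof -
    have "q^2 * r^2 * param_D b c
        = (b * r)^2 * (c * q)^2 + 2 * (b * r)^2 * q^2 - 3 * (b * r)^2 * (c * q) * q
          + (c * q) * q * r^2 - (b * r) * (c * q)^2 * r + 2 * (b * r) * r * q^2"
      unfolding param_D_def by algebra
    also have "\<dots> = 2 * p * (p * (2 * p^2 + q^2 - 2 * p * q) - p^2 * q + q * r^2
                              - r * (2 * p^2 - q^2))"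
      unfolding br cq by algebra
    also have "\<dots> = 2 * p * q * (2 * p * y - p^2 + r^2 - 2 * u * r)"
      unfolding Y U by algebra
    also have "\<dots> = - 4 * p * q * r" using R by algebra
    finally show ?thesis by algebra
  qed
  then have D: "param_D b c * (q * r) = - 4 * p"
    using q r by (simp add: eq_neg_iff_add_eq_0)
  have four: "(4::'a) \<noteq> 0" using two by (metis mult_2_right mult_eq_0_iff numeral_Bit0)
  have D0: "param_D b c \<noteq> 0" using D p four by auto
  have "q^2 * r * (param_D b c * x + b * (c^2 + 2 - 4 * c))
      = (param_D b c * (q * r)) * q * x + (b * r) * ((c * q)^2 + 2 * q^2 - 4 * (c * q) * q)"
    by algebra
  also have "\<dots> = 0" unfolding D br cq using X by algebra
  finally have "param_D b c * x = - (b * (c^2 + 2 - 4 * c))"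
    using q r by (simp add: eq_neg_iff_add_eq_0)
  then have x: "x = param_x b c" using D0 by (simp add: param_x_def field_simps)
  have "q^2 * r * (param_D b c * y + b * (c^2 + 2 - 2 * c))
      = (param_D b c * (q * r)) * q * y + (b * r) * ((c * q)^2 + 2 * q^2 - 2 * (c * q) * q)"
    by algebra
  also have "\<dots> = 0" unfolding D br cq using Y by algebra
  finally have "param_D b c * y = - (b * (c^2 + 2 - 2 * c))"
    using q r by (simp add: eq_neg_iff_add_eq_0)
  then have y: "y = param_y b c" using D0 by (simp add: param_y_def field_simps)
  let ?N = "b^2 * c^2 + 2 * b^2 - 3 * b^2 * c - c"
  \<comment> \<open>Passing from z to z + 1 replaces \<open>?N\<close> by D - \<open>?N\<close> = 2c
    - b(c^2 - 2), which is only linear in b.\<close>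
  have "q^2 * r * (param_D b c * z + ?N)
      = (param_D b c * (q * r)) * q * (z + 1)
        - (2 * (c * q) * q * r - (b * r) * (c * q)^2 + 2 * (b * r) * q^2)"
    unfolding param_D_def by algebra
  also have "\<dots> = 0" unfolding D br cq using U defs by algebra
  finally have "param_D b c * z + ?N = 0" using q r by simp
  then have "param_D b c * z = - ?N" by (simp only: eq_neg_iff_add_eq_0)
  then have z: "z = param_z b c" using D0 by (simp add: param_z_def field_simps)
  show ?thesis
    using D0 x y z unfolding is_param_def b_def c_def p_def q_def r_def by blast
qed

text \<open>Once u is computed from y and z, the surface equation reduces to the identity (c^2 + 2 -
  4c)^2 + (c^2 - 2)^2 = 2(c^2 + 2 - 2c)^2.\<close>

lemma is_param_u_of:
  fixes b c x y z :: "'a::field"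
  assumes two: "(2::'a) \<noteq> 0" and par: "is_param b c x y z"
  defines "D \<equiv> param_D b c"
  shows "D * u_of y z = - (b * (c^2 - 2))" and "on_surface x y z"
proof -
  let ?u = "u_of y z"
  have D: "D \<noteq> 0" and X: "D * x = - (b * (c^2 + 2 - 4 * c))"
    and Y: "D * y = - (b * (c^2 + 2 - 2 * c))"
    and Z: "D * z = - (b^2 * c^2 + 2 * b^2 - 3 * b^2 * c - c)"
    using par by (auto simp: D_def is_param_def param_x_def param_y_def param_z_def)
  have u2: "2 * ?u = y^2 + 1 - z^2" using two by (simp add: u_of_def)
  have "2 * D * (D * ?u) = (D * y)^2 + D^2 - (D * z)^2"
    using u2 by algebra
  also have "\<dots> = 2 * D * - (b * (c^2 - 2))"
    unfolding Y Z unfolding D_def param_D_def by algebra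
  finally show U: "D * ?u = - (b * (c^2 - 2))" using D two
    by (metis mult_cancel_left mult_eq_0_iff)
  have "D^2 * (x^2 + ?u^2 - 2 * y^2) = (D * x)^2 + (D * ?u)^2 - 2 * (D * y)^2"
    by algebra
  also have "\<dots> = 0" unfolding X U Y by algebra
  finally have "x^2 + ?u^2 - 2 * y^2 = 0" using D by simp
  then show "on_surface x y z" using u2 unfolding on_surface_def by algebra
qed

text \<open>The first two formulas locate the zeros of the denominators in terms of b and c. The
  last two are the recovery formulas with denominators cleared, so they hold even where a
  denominator vanishes.\<close>

lemma is_param_dens:
  fixes b c x y z :: "'a::field"
  assumes two: "(2::'a) \<noteq> 0" and par: "is_param b c x y z"
  defines "D \<equiv> param_D b c"
  shows "D * b_den y z = - 2 * c"
    and "D^2 * c_den x y z = 8 * b^2 * (c^2 + 2 - 4 * c)"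
    and "b * b_den y z = y - x"
    and "c * c_den x y z = 4 * x * (y - x)"
proof -
  let ?u = "u_of y z"
  have D: "D \<noteq> 0" and X: "D * x = - (b * (c^2 + 2 - 4 * c))"
    and Y: "D * y = - (b * (c^2 + 2 - 2 * c))"
    and Z: "D * z = - (b^2 * c^2 + 2 * b^2 - 3 * b^2 * c - c)"
    using par by (auto simp: D_def is_param_def param_x_def param_y_def param_z_def)
  have U: "D * ?u = - (b * (c^2 - 2))"
    unfolding D_def by (rule is_param_u_of(1)[OF two par])
  have YX: "D * (y - x) = - (2 * b * c)" using X Y by algebra
  have "D * b_den y z = D * ?u - D * z - D" unfolding b_den_def by algebra
  also have "\<dots> = - 2 * c" unfolding U Z unfolding D_def param_D_def by algebra
  finally show B: "D * b_den y z = - 2 * c" .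
  have "D^2 * c_den x y z = 2 * (D * x) * (2 * (D * y) - D * x - D * ?u)"
    unfolding c_den_eq by algebra
  also have "\<dots> = 8 * b^2 * (c^2 + 2 - 4 * c)" unfolding X Y U by algebra
  finally show C: "D^2 * c_den x y z = 8 * b^2 * (c^2 + 2 - 4 * c)" .
  have "D * (b * b_den y z - (y - x)) = 0" using B YX by algebra
  then show "b * b_den y z = y - x" using D by simp
  have "D^2 * (c * c_den x y z - 4 * x * (y - x)) = 0" using C YX X by algebra
  then show "c * c_den x y z = 4 * x * (y - x)" using D by simp
qed

lemma rat_square_eq_double_square:
  fixes u y :: rat
  assumes "u^2 = 2 * y^2"
  shows "y = 0"
proof (rule ccontr)
  assume "y \<noteq> 0"
  obtain m n where mn: "u / y = Rat.Fract m n" "n > 0" "coprime m n"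
    by (cases "u / y")
  have "(u / y)^2 = 2" using assms \<open>y \<noteq> 0\<close> by (simp add: power_divide)
  then have "(of_int m)^2 = (2 * (of_int n)^2 :: rat)"
    using mn by (simp add: Fract_of_int_quotient power_divide field_simps)
  then have mn2: "m^2 = 2 * n^2"
    by (metis of_int_eq_iff of_int_mult of_int_numeral of_int_power)
  then have "even m" by (metis dvd_triv_left even_power)
  then obtain k where "m = 2 * k" by (elim evenE)
  then have "n^2 = 2 * k^2" using mn2 by algebra
  then have "even n" by (metis dvd_triv_left even_power)
  then show False using \<open>even m\<close> mn(3) by (auto dest: coprime_common_divisor)
qed

text \<open>The rationality of the point enters here: x = 0 would give u^2 = 2y^2, hence y = 0
  because 2 is not a rational square, and then x = y puts the point on a line.\<close>

lemma c_den_nonzero_rat: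
  fixes x y z :: rat
  assumes "on_surface x y z" and "\<not> on_lines x y z"
  shows "c_den x y z \<noteq> 0"
proof -
  have "x \<noteq> 0"
  proof
    assume "x = 0"
    then have "y = 0"
      using conic_of_surface[OF _ assms(1)] rat_square_eq_double_square[of "u_of y z" y] by simp
    then show False using on_linesI[OF _ assms(1)] assms(2) \<open>x = 0\<close> by simp
  qed
  then show ?thesis unfolding c_den_eq using conic_chord_nonzero[OF _ assms] by simp
qed

text \<open>Each expression is the image of an explicit polynomial under the injective map
  \<open>to_fract\<close>; rewriting with \<open>lift\<close> reduces the claims to nonzero
  polynomials in \<rat>[b][c].\<close>

lemma ratfun_nonzero:
  "(2::ratfun) \<noteq> 0" "bvar \<noteq> 0" "cvar \<noteq> 0" "cvar^2 + 2 - 4 * cvar \<noteq> 0"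
  "param_D bvar cvar \<noteq> 0"
proof -
  have num: "numeral k = (to_fract (numeral k) :: ratfun)" for k
    by (induction k) (simp_all only: numeral.simps to_fract_1 to_fract_add)
  have pow: "to_fract p ^ n = (to_fract (p ^ n) :: ratfun)" for p n
    by (induction n) simp_all
  note lift = num pow to_fract_mult[symmetric] to_fract_add[symmetric] to_fract_diff[symmetric]
    to_fract_eq_0_iff
  show "(2::ratfun) \<noteq> 0" unfolding lift by simp
  show "bvar \<noteq> 0" "cvar \<noteq> 0" unfolding bvar_def cvar_def lift by simp_all
  show "cvar^2 + 2 - 4 * cvar \<noteq> 0"
    unfolding cvar_def lift by (simp add: power2_eq_square numeral_poly)
  show "param_D bvar cvar \<noteq> 0"
    unfolding param_D_def bvar_def cvar_def lift
    by (simp add: power2_eq_square numeral_poly)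
qed

theorem theorem2p1:
  shows "(\<forall>x y z :: rat. on_surface x y z \<longrightarrow>
            on_lines x y z \<or> (\<exists>b c :: rat. is_param b c x y z))
       \<and> (\<exists>x y z :: ratfun. is_param bvar cvar x y z
            \<and> on_surface x y z
            \<and> b_den y z \<noteq> 0 \<and> bvar = b_of x y z
            \<and> c_den x y z \<noteq> 0 \<and> cvar = c_of x y z)
       \<and> (\<forall>b c x y z :: rat. is_param b c x y z \<longrightarrow>
            on_surface x y z
            \<and> (b_den y z \<noteq> 0 \<longrightarrow> b = b_of x y z)
            \<and> (c_den x y z \<noteq> 0 \<longrightarrow> c = c_of x y z)
            \<and> (\<not> on_lines x y z \<longrightarrow> b_den y z \<noteq> 0 \<and> c_den x y z \<noteq> 0))"
proof (intro conjI allI impI)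
  fix x y z :: rat
  assume "on_surface x y z"
  then show "on_lines x y z \<or> (\<exists>b c. is_param b c x y z)"
    using is_param_of_surface[of x y z] by auto
next
  \<comment> \<open>The generic point over \<rat>(b, c): its denominators are nonzero because c, b
    and c^2 + 2 - 4c are nonzero as rational functions.\<close>
  define x y z where "x = param_x bvar cvar" and "y = param_y bvar cvar"
    and "z = param_z bvar cvar"
  have par: "is_param bvar cvar x y z"
    using ratfun_nonzero(5) by (simp add: is_param_def x_def y_def z_def)
  note dens = is_param_dens[OF ratfun_nonzero(1) par]
  have eight: "(8::ratfun) \<noteq> 0"
    using ratfun_nonzero(1) power_not_zero[of "2::ratfun" 3] by simp
  have bd: "b_den y z \<noteq> 0" using dens(1) ratfun_nonzero(1,3) by auto
  have cd: "c_den x y z \<noteq> 0" using dens(2) eight ratfun_nonzero(2,4) by auto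
  have "bvar = b_of x y z" using dens(3) bd by (simp add: b_of_def eq_divide_eq)
  moreover have "cvar = c_of x y z" using dens(4) cd by (simp add: c_of_def eq_divide_eq)
  ultimately show "\<exists>x y z :: ratfun. is_param bvar cvar x y z
            \<and> on_surface x y z
            \<and> b_den y z \<noteq> 0 \<and> bvar = b_of x y z
            \<and> c_den x y z \<noteq> 0 \<and> cvar = c_of x y z"
    using par is_param_u_of(2)[OF ratfun_nonzero(1) par] bd cd by blast
next
  fix b c x y z :: rat
  assume par: "is_param b c x y z"
  have two: "(2::rat) \<noteq> 0" by simp
  show surf: "on_surface x y z" by (rule is_param_u_of(2)[OF two par])
  show "b = b_of x y z" if "b_den y z \<noteq> 0"
    using is_param_dens(3)[OF two par] that by (simp add: b_of_def eq_divide_eq)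
  show "c = c_of x y z" if "c_den x y z \<noteq> 0"
    using is_param_dens(4)[OF two par] that by (simp add: c_of_def eq_divide_eq)
  show "b_den y z \<noteq> 0" if "\<not> on_lines x y z" by (rule b_den_nonzero[OF two surf that])
  show "c_den x y z \<noteq> 0" if "\<not> on_lines x y z" by (rule c_den_nonzero_rat[OF surf that])
qed

end
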